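(* Let $(\Omega,\Xi)$ be a measurable space and let $G$ be a $\sigma$-finite kernel on $\Omega$ satisfying the weak maximum principle with constant $\mathfrak{b}\ge1$. Let $0<q<1$. If a measurable function $u>0$ in $\Omega$ satisfies $$u\ge G(u^q)\quad\text{in }\Omega,$$ then $$u(x)\ \ge\ (1-q)^{\frac1{1-q}}\,\mathfrak{b}^{-\frac{q}{1-q}}\,\big(G1(x)\big)^{\frac1{1-q}},\qquad x\in\Omega .$$
   Context: A $\sigma$-finite kernel $G(x,dy)$ on $(\Omega,\Xi)$: for each $x\in\Omega$, $G(x,dy)$ is a $\sigma$-finite measure on $(\Omega,\Xi)$, and for every $\Xi$-measurable $f:\Omega\to[0,\infty]$ the function $Gf(x)=\int_\Omega f(y)\,G(x,dy)$ is $\Xi$-measurable. $G1$ is $Gf$ with $f\equiv1$. Weak maximum principle with constant $\mathfrak{b}\ge1$: for any non-negative bounded measurable function $f$ on $\Omega$, if $Gf\le1$ in $\{f>0\}$, then $Gf\le\mathfrak{b}$ in $\Omega$. *)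

theory Defs
  imports "HOL-Analysis.Analysis"
begin

text \<open>
  The measurable space is \<open>(space M, sets M)\<close>; the measure carried by \<open>M\<close> plays no role.
  Each \<open>G x\<close> is \<open>\<sigma>\<close>-finite on its own; no uniformity in \<open>x\<close> is required.
\<close>

definition kernel_op :: "('a \<Rightarrow> 'a measure) \<Rightarrow> ('a \<Rightarrow> ennreal) \<Rightarrow> 'a \<Rightarrow> ennreal" where
  "kernel_op G f x = (\<integral>\<^sup>+ y. f y \<partial>G x)"

definition sigma_finite_kernel :: "'a measure \<Rightarrow> ('a \<Rightarrow> 'a measure) \<Rightarrow> bool" where
  "sigma_finite_kernel M G \<longleftrightarrow>
     (\<forall>x\<in>space M. sets (G x) = sets M \<and> sigma_finite_measure (G x)) \<and>
     (\<forall>f\<in>borel_measurable M. kernel_op G f \<in> borel_measurable M)"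

definition weak_max_principle :: "'a measure \<Rightarrow> ('a \<Rightarrow> 'a measure) \<Rightarrow> real \<Rightarrow> bool" where
  "weak_max_principle M G b \<longleftrightarrow>
     (\<forall>f :: 'a \<Rightarrow> real.
        f \<in> borel_measurable M \<longrightarrow>
        (\<forall>x\<in>space M. 0 \<le> f x) \<longrightarrow>
        (\<exists>C. \<forall>x\<in>space M. f x \<le> C) \<longrightarrow>
        (\<forall>x\<in>space M. f x > 0 \<longrightarrow> kernel_op G (\<lambda>y. ennreal (f y)) x \<le> 1) \<longrightarrow>
        (\<forall>x\<in>space M. kernel_op G (\<lambda>y. ennreal (f y)) x \<le> ennreal b))"

text \<open>
  Powers \<open>t\<^sup>p\<close> of \<open>t \<in> [0, \<infinity>]\<close>, to be used for exponents \<open>p > 0\<close> only: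
  \<open>0\<^sup>p = 0\<close> and \<open>\<infinity>\<^sup>p = \<infinity>\<close>.
\<close>

definition ennreal_powr :: "ennreal \<Rightarrow> real \<Rightarrow> ennreal" where
  "ennreal_powr t p = (if t = \<infinity> then \<infinity> else ennreal (enn2real t powr p))"

end

theory Submission
  imports Defs
begin

text \<open>
  The truncations \<open>u\<^sup>q 1\<^bsub>{u \<le> t}\<^esub> / t\<close> are bounded and satisfy \<open>G(\<dots>) \<le> u / t \<le> 1\<close> where they are
  positive, so the weak maximum principle yields \<open>G(u\<^sup>q 1\<^bsub>{u \<le> t}\<^esub>) \<le> min (b t) u\<close> everywhere.
  Integrating this against \<open>q t\<^bsup>-q-1\<^esup> dt\<close> over \<open>t > 0\<close> and using the layer cake identity
  \<open>1 = u\<^sup>q \<integral>\<^bsub>t \<ge> u\<^esub> q t\<^bsup>-q-1\<^esup> dt\<close> where \<open>0 < u < \<infinity>\<close>, one gets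
  \<open>G1 \<le> \<integral>\<^bsub>t > 0\<^esub> q t\<^bsup>-q-1\<^esup> min (b t) u dt = b\<^sup>q u\<^bsup>1-q\<^esup> / (1 - q)\<close>.
\<close>

lemma measurable_ennreal_powr [measurable]:
  assumes [measurable]: "f \<in> borel_measurable M"
  shows "(\<lambda>x. ennreal_powr (f x) p) \<in> borel_measurable M"
  unfolding ennreal_powr_def by measurable

lemma ennreal_powr_ennreal:
  "0 \<le> r \<Longrightarrow> ennreal_powr (ennreal r) p = ennreal (r powr p)"
  by (simp add: ennreal_powr_def)

lemma nn_integral_indicator_has_integral:
  fixes f :: "real \<Rightarrow> real"
  assumes [measurable]: "f \<in> borel_measurable borel" "S \<in> sets borel"
    and nonneg: "\<And>x. x \<in> S \<Longrightarrow> 0 \<le> f x"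
    and int: "(f has_integral I) S"
  shows "(\<integral>\<^sup>+ x. ennreal (f x) * indicator S x \<partial>lborel) = ennreal I"
proof -
  have "((\<lambda>x. if x \<in> S then f x else 0) has_integral I) UNIV"
    using int by (simp add: has_integral_restrict_UNIV)
  then have "((\<lambda>x. indicator S x * f x) has_integral I) UNIV"
    by (rule has_integral_eq[rotated]) (auto simp: indicator_def)
  then have "(\<integral>\<^sup>+ x. ennreal (indicator S x * f x) \<partial>lborel) = ennreal I"
    by (intro nn_integral_has_integral_lborel) (auto simp: indicator_def nonneg)
  moreover have "ennreal (indicator S x * f x) = ennreal (f x) * indicator S x" for x
    by (auto simp: indicator_def)
  ultimately show ?thesis by simp
qed

text \<open>The factor \<open>q\<close> normalises the weight: \<open>q * t powr (- q - 1)\<close>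
  is minus the derivative of \<open>t powr (- q)\<close>, so the tail mass from \<open>a\<close> is
  exactly the reciprocal of \<open>a powr q\<close>.\<close>

lemma nn_integral_powr_tail:
  fixes a q :: real
  assumes "0 < a" "0 < q"
  shows "(\<integral>\<^sup>+ t. ennreal (q * t powr (- q - 1)) * indicator {a..} t \<partial>lborel) = ennreal (a powr (- q))"
proof -
  have "((\<lambda>t. q * t powr (- q - 1)) has_integral q * (- (a powr (- q - 1 + 1)) / (- q - 1 + 1))) {a..}"
    using assms by (intro has_integral_mult_right has_integral_powr_to_inf) auto
  then show ?thesis
    using assms by (intro nn_integral_indicator_has_integral) auto
qed

text \<open>Neither branch of the minimum suffices alone: \<open>b * t\<close> makes the integrand
  of order \<open>t powr (- q)\<close>, integrable at 0 because \<open>q < 1\<close>, while the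
  constant \<open>U\<close> leaves \<open>t powr (- q - 1)\<close>, integrable at infinity because
  \<open>0 < q\<close>.\<close>

lemma nn_integral_powr_min_le:
  fixes U b q :: real
  assumes "0 < U" "0 < b" "0 < q" "q < 1"
  shows "(\<integral>\<^sup>+ t. ennreal (q * t powr (- q - 1) * min (b * t) U) * indicator {0<..} t \<partial>lborel)
           \<le> ennreal (b powr q / (1 - q) * U powr (1 - q))"
proof -
  \<comment> \<open>The crossover of the two branches. The closed intervals below both contain
    \<open>T\<close>; counting that point twice is harmless in an upper bound and has measure
    zero.\<close>
  define T where "T = U / b"
  have T: "0 < T" "b * T = U" using assms by (auto simp: T_def)
  have "(\<integral>\<^sup>+ t. ennreal (q * t powr (- q - 1) * min (b * t) U) * indicator {0<..} t \<partial>lborel)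
     \<le> (\<integral>\<^sup>+ t. ennreal (q * b * t powr (- q)) * indicator {0..T} t
               + ennreal U * (ennreal (q * t powr (- q - 1)) * indicator {T..} t) \<partial>lborel)"
  proof (rule nn_integral_mono)
    fix t :: real
    consider "t \<le> 0" | "0 < t" "t < T" | "0 < t" "T \<le> t" by linarith
    then show "ennreal (q * t powr (- q - 1) * min (b * t) U) * indicator {0<..} t
       \<le> ennreal (q * b * t powr (- q)) * indicator {0..T} t
          + ennreal U * (ennreal (q * t powr (- q - 1)) * indicator {T..} t)"
    proof cases
      case 2
      have "t powr (- q) = t powr (- q - 1) * t"
        using 2 by (simp add: powr_diff)
      moreover have "q * t powr (- q - 1) * min (b * t) U \<le> q * t powr (- q - 1) * (b * t)"
        using assms(3) by (intro mult_left_mono) auto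
      ultimately have "q * t powr (- q - 1) * min (b * t) U \<le> q * b * t powr (- q)"
        by (simp add: mult_ac)
      then show ?thesis using 2 by (simp add: ennreal_leI)
    next
      case 3
      have "q * t powr (- q - 1) * min (b * t) U \<le> U * (q * t powr (- q - 1))"
        using assms(3) by (simp add: mult_ac mult_right_mono)
      then have "ennreal (q * t powr (- q - 1) * min (b * t) U)
          \<le> ennreal U * ennreal (q * t powr (- q - 1))"
        using assms by (simp add: ennreal_leI flip: ennreal_mult)
      then show ?thesis using 3 by (simp add: add_increasing)
    qed simp
  qed
  also have "\<dots> = (\<integral>\<^sup>+ t. ennreal (q * b * t powr (- q)) * indicator {0..T} t \<partial>lborel)
      + ennreal U * (\<integral>\<^sup>+ t. ennreal (q * t powr (- q - 1)) * indicator {T..} t \<partial>lborel)"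
    by (subst nn_integral_add) (auto simp: nn_integral_cmult)
  also have "(\<integral>\<^sup>+ t. ennreal (q * b * t powr (- q)) * indicator {0..T} t \<partial>lborel)
      = ennreal (q * b * (T powr (1 - q) / (1 - q)))"
  proof -
    have "((\<lambda>t. q * b * t powr (- q)) has_integral q * b * (T powr (- q + 1) / (- q + 1))) {0..T}"
      using assms T by (intro has_integral_mult_right has_integral_powr_from_0) auto
    then show ?thesis
      using assms by (intro nn_integral_indicator_has_integral) auto
  qed
  also have "(\<integral>\<^sup>+ t. ennreal (q * t powr (- q - 1)) * indicator {T..} t \<partial>lborel) = ennreal (T powr (- q))"
    using T assms by (intro nn_integral_powr_tail)
  also have "ennreal (q * b * (T powr (1 - q) / (1 - q))) + ennreal U * ennreal (T powr (- q))
      = ennreal (q * b * (T powr (1 - q) / (1 - q)) + U * T powr (- q))"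
    using assms by (simp flip: ennreal_mult ennreal_plus)
  also have "q * b * (T powr (1 - q) / (1 - q)) + U * T powr (- q) = b powr q / (1 - q) * U powr (1 - q)"
  proof -
    \<comment> \<open>Everything is expressed through \<open>b * T powr (1 - q)\<close>; the
      coefficients then add up by q/(1-q) + 1 = 1/(1-q).\<close>
    have "U * T powr (- q) = b * T powr (1 - q)"
      using T by (simp add: powr_diff powr_minus_divide flip: T(2))
    moreover have "b powr q * U powr (1 - q) = b * T powr (1 - q)"
      using T(1) assms by (simp add: powr_mult powr_diff flip: T(2))
    ultimately show ?thesis
      using assms(4) by (simp add: field_simps)
  qed
  finally show ?thesis .
qed

text \<open>The cutoff \<open>u y \<le> ennreal t\<close> serves twice: it bounds the test function,
  and it forces \<open>u \<le> t\<close> wherever the test function is positive, which is where the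
  weak maximum principle asks for a bound.\<close>

lemma kernel_op_truncation_le:
  assumes G: "sigma_finite_kernel M G"
    and wmp: "weak_max_principle M G b"
    and "0 \<le> b" "0 < q" "0 < t"
    and u [measurable]: "u \<in> borel_measurable M"
    and super: "\<forall>x\<in>space M. kernel_op G (\<lambda>y. ennreal_powr (u y) q) x \<le> u x"
    and x: "x \<in> space M"
  shows "kernel_op G (\<lambda>y. ennreal_powr (u y) q * indicator {y. u y \<le> ennreal t} y) x \<le> ennreal (b * t)"
proof -
  define g where "g y = ennreal_powr (u y) q * indicator {y. u y \<le> ennreal t} y" for y
  \<comment> \<open>Real-valued form of \<open>g / t\<close>, as the weak maximum principle speaks
    of real functions. Points with \<open>u y = \<infinity>\<close> lie outside the cutoff, so
    \<open>enn2real\<close> loses nothing.\<close>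
  define f where "f y = (if u y \<le> ennreal t then enn2real (u y) powr q / t else 0)" for y
  have f_meas: "f \<in> borel_measurable M"
    unfolding f_def by measurable
  have g_meas [measurable]: "g \<in> borel_measurable M"
    unfolding g_def indicator_def by measurable
  have f_eq: "ennreal (f y) = ennreal (1 / t) * g y" for y
  proof (cases "u y \<le> ennreal t")
    case True
    then have "u y \<noteq> \<infinity>" by (auto simp: top_unique)
    then show ?thesis using True \<open>0 < t\<close>
      by (simp add: f_def g_def ennreal_powr_def flip: ennreal_mult)
  qed (simp add: f_def g_def)
  have G_f: "kernel_op G (\<lambda>y. ennreal (f y)) z = ennreal (1 / t) * kernel_op G g z"
    if "z \<in> space M" for z
  proof -
    have "sets (G z) = sets M" using G that by (simp add: sigma_finite_kernel_def)
    then have "g \<in> borel_measurable (G z)" using g_meas by (simp cong: measurable_cong_sets)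
    then show ?thesis by (simp add: kernel_op_def f_eq nn_integral_cmult)
  qed
  have f_bound: "f y \<le> t powr q / t" for y
  proof (cases "u y \<le> ennreal t")
    case True
    then have "enn2real (u y) \<le> t" using \<open>0 < t\<close> by (intro enn2real_leI) auto
    then show ?thesis using True \<open>0 < t\<close> \<open>0 < q\<close>
      by (simp add: f_def divide_right_mono powr_mono2)
  qed (use \<open>0 < t\<close> in \<open>simp add: f_def\<close>)
  have f_small: "kernel_op G (\<lambda>y. ennreal (f y)) z \<le> 1" if z: "z \<in> space M" and "0 < f z" for z
  proof -
    have "u z \<le> ennreal t" using that by (auto simp: f_def split: if_splits)
    have "kernel_op G g z \<le> kernel_op G (\<lambda>y. ennreal_powr (u y) q) z"
      unfolding kernel_op_def g_def by (intro nn_integral_mono) (auto simp: indicator_def)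
    also have "\<dots> \<le> ennreal t" using super z \<open>u z \<le> ennreal t\<close> order_trans by blast
    finally have "ennreal (1 / t) * kernel_op G g z \<le> ennreal (1 / t) * ennreal t"
      by (intro mult_left_mono) auto
    also have "\<dots> = 1" using \<open>0 < t\<close> by (simp flip: ennreal_mult)
    finally show ?thesis using G_f[OF z] by simp
  qed
  have "kernel_op G (\<lambda>y. ennreal (f y)) x \<le> ennreal b"
    using wmp[unfolded weak_max_principle_def, rule_format, of f x] f_meas f_bound f_small x \<open>0 < t\<close>
    by (force simp: f_def)
  then have "ennreal t * (ennreal (1 / t) * kernel_op G g x) \<le> ennreal t * ennreal b"
    using G_f[OF x] by (intro mult_left_mono) auto
  also have "ennreal t * (ennreal (1 / t) * kernel_op G g x) = kernel_op G g x"
    using \<open>0 < t\<close> by (simp flip: mult.assoc ennreal_mult)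
  finally show ?thesis using \<open>0 < t\<close> \<open>0 \<le> b\<close>
    by (simp add: g_def [abs_def] mult.commute flip: ennreal_mult)
qed

text \<open>Finiteness of \<open>u x\<close> at the one point \<open>x\<close> is enough: it makes
  \<open>u\<close> finite almost everywhere for \<open>G x\<close>, and this is all that the layer
  cake identity requires under the integral.\<close>

lemma kernel_op_one_le:
  assumes G: "sigma_finite_kernel M G"
    and wmp: "weak_max_principle M G b"
    and "0 < b" "0 < q" "q < 1"
    and u [measurable]: "u \<in> borel_measurable M"
    and pos: "\<forall>x\<in>space M. 0 < u x"
    and super: "\<forall>x\<in>space M. kernel_op G (\<lambda>y. ennreal_powr (u y) q) x \<le> u x"
    and x: "x \<in> space M"
    and ux: "u x = ennreal U" and "0 < U"
  shows "kernel_op G (\<lambda>_. 1) x \<le> ennreal (b powr q / (1 - q) * U powr (1 - q))"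
proof -
  have sets_G [measurable_cong]: "sets (G x) = sets M"
    using G x by (simp add: sigma_finite_kernel_def)
  then have space_G: "space (G x) = space M" by (rule sets_eq_imp_space_eq)
  interpret sigma_finite_measure "G x"
    using G x by (simp add: sigma_finite_kernel_def)
  \<comment> \<open>The \<sigma>-finiteness of \<open>G x\<close> enters here; it permits exchanging
    the integrals in \<open>y\<close> and \<open>t\<close> below.\<close>
  interpret P: pair_sigma_finite "G x" lborel ..
  define g where "g t y = ennreal_powr (u y) q * indicator {y. u y \<le> ennreal t} y" for t y
  define w where "w t = ennreal (q * t powr (- q - 1)) * indicator {0<..} t" for t :: real
  have w_meas [measurable]: "w \<in> borel_measurable borel"
    unfolding w_def by measurable
  have g_meas [measurable]: "(\<lambda>(y, t). g t y) \<in> borel_measurable (G x \<Otimes>\<^sub>M lborel)"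
    unfolding g_def indicator_def by measurable
  have G_uq: "(\<integral>\<^sup>+ y. ennreal_powr (u y) q \<partial>G x) \<le> ennreal U"
    using super x ux by (metis kernel_op_def)
  \<comment> \<open>Where \<open>u y = \<infinity>\<close> every truncation \<open>g t y\<close>
    vanishes and the layer cake integral is 0 instead of 1, so such points must form a null
    set.\<close>
  have "(\<integral>\<^sup>+ y. ennreal_powr (u y) q \<partial>G x) \<noteq> \<infinity>"
    using G_uq by (auto simp: top_unique)
  then have "AE y in G x. ennreal_powr (u y) q \<noteq> \<infinity>"
    by (intro nn_integral_noteq_infinite) auto
  then have "AE y in G x. 1 = (\<integral>\<^sup>+ t. w t * g t y \<partial>lborel)"
  proof (rule AE_mp, intro AE_I2 impI)
    fix y assume y: "y \<in> space (G x)" and "ennreal_powr (u y) q \<noteq> \<infinity>"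
    then have "u y \<noteq> \<infinity>" by (auto simp: ennreal_powr_def)
    then obtain r where r: "u y = ennreal r" "0 < r"
      using pos y space_G by (cases "u y") (auto)
    \<comment> \<open>For fixed \<open>y\<close> the cutoff reads \<open>r \<le> t\<close>, which
      implies \<open>0 < t\<close> and so absorbs the indicator in \<open>w\<close>.\<close>
    have "w t * g t y = ennreal (r powr q) * (ennreal (q * t powr (- q - 1)) * indicator {r..} t)" for t
      using r by (auto simp: w_def g_def indicator_def ennreal_powr_ennreal mult_ac)
    then have "(\<integral>\<^sup>+ t. w t * g t y \<partial>lborel) = ennreal (r powr q) * ennreal (r powr (- q))"
      using r \<open>0 < q\<close> by (simp add: nn_integral_cmult nn_integral_powr_tail)
    also have "\<dots> = 1"
      using r by (simp flip: ennreal_mult powr_add)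
    finally show "1 = (\<integral>\<^sup>+ t. w t * g t y \<partial>lborel)" by simp
  qed
  then have "kernel_op G (\<lambda>_. 1) x = (\<integral>\<^sup>+ y. (\<integral>\<^sup>+ t. w t * g t y \<partial>lborel) \<partial>G x)"
    unfolding kernel_op_def by (rule nn_integral_cong_AE)
  also have "\<dots> = (\<integral>\<^sup>+ t. (\<integral>\<^sup>+ y. w t * g t y \<partial>G x) \<partial>lborel)"
    by (rule P.Fubini'[symmetric]) measurable
  also have "\<dots> \<le> (\<integral>\<^sup>+ t. ennreal (q * t powr (- q - 1) * min (b * t) U) * indicator {0<..} t \<partial>lborel)"
  proof (rule nn_integral_mono)
    fix t :: real
    show "(\<integral>\<^sup>+ y. w t * g t y \<partial>G x)
       \<le> ennreal (q * t powr (- q - 1) * min (b * t) U) * indicator {0<..} t"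
    proof (cases "0 < t")
      case True
      \<comment> \<open>The first bound comes from the maximum principle, the next one from dropping
        the cutoff and using the supersolution inequality at \<open>x\<close>; together they give
        the minimum.\<close>
      have "kernel_op G (g t) x \<le> ennreal (b * t)"
        using kernel_op_truncation_le[OF G wmp _ \<open>0 < q\<close> True u super x] \<open>0 < b\<close>
        by (simp add: g_def [abs_def])
      moreover have "(\<integral>\<^sup>+ y. g t y \<partial>G x) \<le> (\<integral>\<^sup>+ y. ennreal_powr (u y) q \<partial>G x)"
        by (intro nn_integral_mono) (auto simp: g_def indicator_def)
      ultimately have "(\<integral>\<^sup>+ y. g t y \<partial>G x) \<le> ennreal (min (b * t) U)"
        using G_uq by (auto simp: kernel_op_def min_def)
      then have "w t * (\<integral>\<^sup>+ y. g t y \<partial>G x) \<le> w t * ennreal (min (b * t) U)"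
        by (intro mult_left_mono) auto
      moreover have "(\<integral>\<^sup>+ y. w t * g t y \<partial>G x) = w t * (\<integral>\<^sup>+ y. g t y \<partial>G x)"
        by (intro nn_integral_cmult) measurable
      ultimately show ?thesis
        using True \<open>0 < q\<close> \<open>0 < b\<close> \<open>0 < U\<close> by (simp add: w_def flip: ennreal_mult)
    qed (simp add: w_def)
  qed
  also have "\<dots> \<le> ennreal (b powr q / (1 - q) * U powr (1 - q))"
    using assms by (intro nn_integral_powr_min_le) auto
  finally show ?thesis .
qed

theorem corollary3p6:
  fixes M :: "'a measure"
    and G :: "'a \<Rightarrow> 'a measure"
    and b q :: real
    and u :: "'a \<Rightarrow> ennreal"
  assumes "sigma_finite_kernel M G"
    and "b \<ge> 1"
    and "weak_max_principle M G b"
    and "0 < q" and "q < 1"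
    and "u \<in> borel_measurable M"
    and "\<forall>x\<in>space M. u x > 0"
    and "\<forall>x\<in>space M. u x \<ge> kernel_op G (\<lambda>y. ennreal_powr (u y) q) x"
  shows "\<forall>x\<in>space M.
    u x \<ge> ennreal ((1 - q) powr (1 / (1 - q)) * b powr (- (q / (1 - q))))
            * ennreal_powr (kernel_op G (\<lambda>_. 1) x) (1 / (1 - q))"
proof
  fix x assume x: "x \<in> space M"
  define p where "p = 1 / (1 - q)"
  have p: "0 < p" "(1 - q) * p = 1" using assms(5) by (auto simp: p_def)
  show "u x \<ge> ennreal ((1 - q) powr (1 / (1 - q)) * b powr (- (q / (1 - q))))
            * ennreal_powr (kernel_op G (\<lambda>_. 1) x) (1 / (1 - q))"
  \<comment> \<open>An infinite \<open>u x\<close> makes the claim trivial; a finite one leaves the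
    bound on \<open>G1\<close> to be solved for \<open>U\<close>.\<close>
  proof (cases "u x")
    case (real U)
    have "0 < U" using real assms(7) x by (auto)
    have "0 < b" using assms(2) by simp
    define c where "c = b powr q / (1 - q) * U powr (1 - q)"
    have "kernel_op G (\<lambda>_. 1) x \<le> ennreal c"
      unfolding c_def using kernel_op_one_le[OF assms(1,3) \<open>0 < b\<close> assms(4-8) x real(2) \<open>0 < U\<close>] .
    \<comment> \<open>Finiteness turns \<open>ennreal_powr\<close> into an ordinary real
      power.\<close>
    moreover from this have "kernel_op G (\<lambda>_. 1) x \<noteq> \<infinity>" by (auto simp: top_unique)
    moreover have "0 \<le> c" using assms(5) by (simp add: c_def)
    ultimately obtain g where g: "kernel_op G (\<lambda>_. 1) x = ennreal g" "0 \<le> g" "g \<le> c"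
      by (cases "kernel_op G (\<lambda>_. 1) x") auto
    \<comment> \<open>The constant in the theorem is the one for which replacing \<open>g\<close> by
      \<open>c\<close> gives exactly \<open>U\<close>, since the exponent \<open>(1 - q) * p\<close>
      of \<open>U\<close> is 1.\<close>
    have "(1 - q) powr p * b powr (- (q * p)) * g powr p
        \<le> (1 - q) powr p * b powr (- (q * p)) * c powr p"
      using g p by (intro mult_left_mono powr_mono2) auto
    also have "c powr p = b powr (q * p) / (1 - q) powr p * U"
      using p \<open>0 < U\<close> \<open>0 < b\<close> assms(5) by (simp add: c_def powr_mult powr_divide powr_powr)
    also have "(1 - q) powr p * b powr (- (q * p)) * \<dots> = U"
      using \<open>0 < b\<close> assms(5) by (simp add: powr_minus field_simps)
    finally show ?thesis
      using g real by (simp add: p_def ennreal_powr_ennreal ennreal_leI flip: ennreal_mult)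
  qed simp
qed

end
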